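(* Let $1\le q<\infty$ and let $\mathbb{X}$ be a metric measure space with a polar decomposition at $a\in\mathbb{X}$. Let $u,v>0$ be measurable functions positive a.e. in $\mathbb{X}$ such that $u\in L^1(\mathbb{X}\setminus\{a\})$ and $v\in L^1_{loc}(\mathbb{X})$. Then the inequality $$\left[\int_{\mathbb{X}}\left(\int_{\mathbb{B}(a,|x|_a)}|f(z)|\,dz\right)^q u(x)\,dx\right]^{\frac1q}\le C\left\{\int_{\mathbb{X}}|f(x)|\,v(x)\,dx\right\}$$ holds for all measurable functions $f:\mathbb{X}\to\mathbb{C}$ if and only if the following condition holds: $$A:=\sup_{R>0}\left(\int_{\mathbb{X}\setminus\mathbb{B}(a,R)}u(y)\,dy\right)^{\frac1q}\left(\sup_{y\in\mathbb{B}(a,R)}v^{-1}(y)\right)<\infty .$$ The best constant $C$ in the inequality is given by $C=A$.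
   Context: Let $(\mathbb{X},d)$ be a metric space with a Borel measure $dx$. It is said to have a polar decomposition at $a\in\mathbb{X}$ if there is a locally integrable function $\lambda\in L^1_{loc}$ such that for all $f\in L^1(\mathbb{X})$ $$\int_{\mathbb{X}}f(x)\,dx=\int_0^\infty\int_{\Sigma_r}f(r,\omega)\,\lambda(r,\omega)\,d\omega_r\,dr,$$ where $\Sigma_r=\{x\in\mathbb{X}:d(x,a)=r\}$ carries a measure denoted $d\omega_r$, points of $\Sigma_r$ are written $x=(r,\omega)$, and $(r,\omega)\to a$ as $r\to0$. No differential structure on $\mathbb{X}$ and no doubling condition on the measure is assumed. Notation: $|x|_a:=d(x,a)$; $\mathbb{B}(a,r):=\{x\in\mathbb{X}:d(x,a)\le r\}$ is the closed ball; $v^{-1}=1/v$. In the inequality, $C$ denotes a finite constant independent of $f$.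
   Formalization: In the condition A, the supremum of 1/v over the ball B(a,R) is taken as the essential supremum (with a pointwise supremum the claim fails when v is altered on a null set), and the product 0 times infinity in A is read as 0. *)

theory Defs
  imports "HOL-Probability.Essential_Supremum"
begin

definition locally_integrable ::
    "'a::metric_space measure \<Rightarrow> ('a \<Rightarrow> real) \<Rightarrow> bool"
  where "locally_integrable \<mu> g \<longleftrightarrow>
    g \<in> borel_measurable \<mu> \<and> (\<forall>K. compact K \<longrightarrow> set_integrable \<mu> K g)"

text \<open>
  A point of \<open>sphere a r\<close> with polar coordinates \<open>(r, \<omega>)\<close> is represented by the point \<open>x\<close> of the
  space itself (so \<open>r = dist x a\<close>); hence \<open>(r, \<omega>) \<rightarrow> a\<close> as \<open>r \<rightarrow> 0\<close> holds automatically, and the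
  density \<open>lam\<close> is a function of \<open>x\<close>.  The measure \<open>\<sigma> r\<close> on the Borel sets of the sphere is
  written \<open>d\<omega>\<^sub>r\<close> in informal notation.  Because the Bochner integral is total, the
  existence of the integrals on the right-hand side of the polar formula is stated explicitly.
\<close>

definition polar_decomposition ::
    "'a::metric_space measure \<Rightarrow> 'a \<Rightarrow> (real \<Rightarrow> 'a measure) \<Rightarrow> ('a \<Rightarrow> real) \<Rightarrow> bool"
  where "polar_decomposition \<mu> a \<sigma> lam \<longleftrightarrow>
    locally_integrable \<mu> lam \<and>
    (\<forall>r>0. sets (\<sigma> r) = sets (restrict_space borel (sphere a r))) \<and>
    (\<forall>f :: 'a \<Rightarrow> complex. integrable \<mu> f \<longrightarrow>
      (AE r in lebesgue. r > 0 \<longrightarrow> integrable (\<sigma> r) (\<lambda>x. f x * of_real (lam x))) \<and>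
      set_integrable lebesgue {0<..} (\<lambda>r. LINT x|\<sigma> r. f x * of_real (lam x)) \<and>
      (LINT x|\<mu>. f x) = (LINT r:{0<..}|lebesgue. (LINT x|\<sigma> r. f x * of_real (lam x))))"

definition has_polar_decomposition :: "'a::metric_space measure \<Rightarrow> 'a \<Rightarrow> bool"
  where "has_polar_decomposition \<mu> a \<longleftrightarrow> (\<exists>\<sigma> lam. polar_decomposition \<mu> a \<sigma> lam)"

text \<open>Real powers of elements of \<open>[0, \<infinity>]\<close>; meant for exponents \<open>p > 0\<close> only.\<close>

definition ennreal_powr :: "ennreal \<Rightarrow> real \<Rightarrow> ennreal"
  where "ennreal_powr x p = (if x = top then top else ennreal (enn2real x powr p))"

text \<open>
  All integrands are nonnegative, so both sides of the inequality are taken in \<open>[0, \<infinity>]\<close>.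
\<close>

definition hardy_inequality ::
    "'a::metric_space measure \<Rightarrow> 'a \<Rightarrow> real \<Rightarrow> ('a \<Rightarrow> real) \<Rightarrow> ('a \<Rightarrow> real) \<Rightarrow> ennreal
      \<Rightarrow> ('a \<Rightarrow> complex) \<Rightarrow> bool"
  where "hardy_inequality \<mu> a q u v C f \<longleftrightarrow>
    ennreal_powr
      (\<integral>\<^sup>+x. ennreal_powr (\<integral>\<^sup>+z\<in>cball a (dist x a). ennreal (norm (f z)) \<partial>\<mu>) q
             * ennreal (u x) \<partial>\<mu>) (1 / q)
    \<le> C * (\<integral>\<^sup>+x. ennreal (norm (f x)) * ennreal (v x) \<partial>\<mu>)"

text \<open>
  The weights are constrained only almost everywhere, so the supremum of \<open>1 / v\<close> over a ball is
  the essential supremum: with a pointwise supremum, the constant would change when \<open>v\<close> is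
  altered on a null set, whereas the inequality would not.  In \<open>ennreal\<close>, \<open>inverse 0 = top\<close> and
  \<open>0 * top = 0\<close>; the latter convention matters for balls of full measure.
\<close>

definition hardy_constant ::
    "'a::metric_space measure \<Rightarrow> 'a \<Rightarrow> real \<Rightarrow> ('a \<Rightarrow> real) \<Rightarrow> ('a \<Rightarrow> real) \<Rightarrow> ennreal"
  where "hardy_constant \<mu> a q u v =
    (SUP R\<in>{0<..}.
      ennreal_powr (\<integral>\<^sup>+y\<in>- cball a R. ennreal (u y) \<partial>\<mu>) (1 / q)
      * esssup (restrict_space \<mu> (cball a R)) (\<lambda>y. inverse (ennreal (v y))))"

end

theory Submission
  imports Defs
begin

text \<open>
  The polar decomposition enters only through the fact that spheres around \<open>a\<close> are null sets; local
  integrability of \<open>v > 0\<close> excludes an atom of infinite mass at \<open>a\<close>, and integrability of \<open>u > 0\<close>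
  makes \<open>\<mu>\<close> \<open>\<sigma>\<close>-finite.  Let \<open>A\<close> be the Hardy constant, \<open>U R\<close> the \<open>u\<close>-mass outside the ball of
  radius \<open>R\<close>, and \<open>|z| = dist z a\<close>.  Finiteness of \<open>A\<close> amounts to \<open>U |z| \<le> (A v(z))\<^sup>q\<close> for almost all
  \<open>z\<close>.  Jensen's inequality for the measure \<open>|f| v dz\<close> of total mass \<open>K\<close> gives
  \<open>F(x)\<^sup>q \<le> K\<^sup>q\<^sup>-\<^sup>1 \<integral>\<^bsub>|z| \<le> |x|\<^esub> v(z)\<^sup>-\<^sup>q |f(z)| v(z) dz\<close> for \<open>F(x) = \<integral>\<^bsub>|z| \<le> |x|\<^esub> |f(z)| dz\<close>; integrating
  against \<open>u\<close> and exchanging the integrals yields \<open>\<integral> F\<^sup>q u \<le> (A K)\<^sup>q\<close>.  Optimality of \<open>A\<close> follows by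
  testing with indicators of sets of finite measure inside a ball.
\<close>

section \<open>Real powers on the extended half-line\<close>

lemma ennreal_powr_ennreal: "0 \<le> x \<Longrightarrow> ennreal_powr (ennreal x) p = ennreal (x powr p)"
  by (simp add: ennreal_powr_def)

lemma ennreal_powr_0 [simp]: "ennreal_powr 0 p = 0"
  by (simp add: ennreal_powr_def)

lemma ennreal_powr_mono: "x \<le> y \<Longrightarrow> 0 \<le> p \<Longrightarrow> ennreal_powr x p \<le> ennreal_powr y p"
  unfolding ennreal_powr_def
  by (auto simp: top_unique less_top intro!: ennreal_leI powr_mono2 enn2real_mono)

lemma ennreal_powr_cancel: "0 < p \<Longrightarrow> ennreal_powr (ennreal_powr x p) (1 / p) = x"
  by (cases x rule: ennreal_cases) (auto simp: ennreal_powr_def powr_powr)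

lemma ennreal_powr_mult:
  "ennreal_powr (ennreal c * x) p = ennreal (c powr p) * ennreal_powr x p" if "0 < c"
  using that
  by (cases x rule: ennreal_cases)
    (auto simp: ennreal_powr_def ennreal_mult_top powr_mult simp flip: ennreal_mult)

lemma borel_measurable_ennreal_powr [measurable]:
  "(\<lambda>x. ennreal_powr x p) \<in> borel_measurable borel"
  unfolding ennreal_powr_def by measurable

section \<open>Jensen's inequality for powers, against a measure of finite mass\<close>

text \<open>Convexity of \<open>t powr q\<close>: the tangent at \<open>m\<close> lies below the
  graph. This is Young's inequality with weights \<open>1 / q\<close> and
  \<open>(q - 1) / q\<close>, arranged without negative terms so that it can be integrated in
  \<open>ennreal\<close>.\<close>

lemma powr_tangent_le:
  fixes t m q :: real
  assumes "1 \<le> q" "0 \<le> t" "0 < m"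
  shows "q * m powr (q - 1) * t \<le> t powr q + (q - 1) * m powr q"
proof (cases "t = 0")
  case False
  then have "(t powr q) powr (1 / q) * (m powr q) powr ((q - 1) / q)
      \<le> 1 / q * t powr q + (q - 1) / q * m powr q"
    using assms by (intro Youngs_inequality_0) (auto simp: field_simps)
  then have "t * m powr (q - 1) \<le> 1 / q * t powr q + (q - 1) / q * m powr q"
    using assms by (simp add: powr_powr)
  then have "q * (t * m powr (q - 1)) \<le> q * (1 / q * t powr q + (q - 1) / q * m powr q)"
    using assms by (intro mult_left_mono) auto
  also have "\<dots> = t powr q + (q - 1) * m powr q"
    using assms by (simp add: field_simps)
  finally show ?thesis by (simp add: mult_ac)
qed (use assms in auto)

text \<open>Integrate the tangent inequality against \<open>k\<close>, with the tangent taken at the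
  mean of \<open>h\<close>. The mass \<open>K\<close> is not normalised, whence the factor
  \<open>K powr (q - 1)\<close>.\<close>

lemma nn_integral_powr_jensen:
  fixes h :: "'a \<Rightarrow> real" and k :: "'a \<Rightarrow> ennreal"
  assumes [measurable]: "h \<in> borel_measurable M" "k \<in> borel_measurable M"
    and h: "\<And>x. 0 \<le> h x" and q: "1 \<le> q" and K: "0 < K" "(\<integral>\<^sup>+x. k x \<partial>M) = ennreal K"
  shows "ennreal_powr (\<integral>\<^sup>+x. ennreal (h x) * k x \<partial>M) q
    \<le> ennreal (K powr (q - 1)) * (\<integral>\<^sup>+x. ennreal (h x powr q) * k x \<partial>M)"
proof (cases "\<integral>\<^sup>+x. ennreal (h x powr q) * k x \<partial>M" rule: ennreal_cases)
  case top
  then show ?thesis using K by (simp add: ennreal_mult_top)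
next
  case (real J)
  define I where "I = (\<integral>\<^sup>+x. ennreal (h x) * k x \<partial>M)"
  \<comment> \<open>The tangent point stays free: \<open>m = 1\<close> first shows that
    \<open>I\<close> is finite, and only then can \<open>m\<close> be the mean
    \<open>I / K\<close>.\<close>
  have ineq: "ennreal (q * m powr (q - 1)) * I \<le> ennreal (J + (q - 1) * m powr q * K)"
    if m: "0 < m" for m
  proof -
    have "ennreal (q * m powr (q - 1)) * I
        = (\<integral>\<^sup>+x. ennreal (q * m powr (q - 1) * h x) * k x \<partial>M)"
      unfolding I_def using q h
      by (subst nn_integral_cmult[symmetric]) (auto simp: ennreal_mult mult.assoc)
    also have "\<dots> \<le> (\<integral>\<^sup>+x. ennreal (h x powr q) * k x + ennreal ((q - 1) * m powr q) * k x \<partial>M)"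
      using powr_tangent_le[OF q h m] q
      by (intro nn_integral_mono)
        (auto simp flip: distrib_right ennreal_plus intro!: mult_right_mono ennreal_leI)
    also have "\<dots> = ennreal (J + (q - 1) * m powr q * K)"
      using real K q by (subst nn_integral_add) (auto simp: nn_integral_cmult ennreal_mult)
    finally show ?thesis .
  qed
  have "ennreal q * I < top"
    using ineq[of 1] by (simp add: le_less_trans[OF _ ennreal_less_top])
  then have "I \<noteq> top" using q by (auto simp: ennreal_mult_top)
  then obtain i where i: "I = ennreal i" "0 \<le> i" by (cases I rule: ennreal_cases) auto
  have "i powr q \<le> K powr (q - 1) * J"
  proof (cases "i = 0")
    case False
    define m where "m = i / K"
    have m: "0 < m" "i = m * K" using False i K by (auto simp: m_def)
    have "q * m powr (q - 1) * i \<le> J + (q - 1) * m powr q * K"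
    proof -
      have "ennreal (q * m powr (q - 1) * i) = ennreal (q * m powr (q - 1)) * ennreal i"
        using q i by (intro ennreal_mult) auto
      also have "\<dots> \<le> ennreal (J + (q - 1) * m powr q * K)"
        using ineq[OF m(1)] i by simp
      finally show ?thesis
        by (subst (asm) ennreal_le_iff) (use q K real in auto)
    qed
    moreover have "m powr (q - 1) * i = m powr q * K"
      using m(1) unfolding m(2) by (simp add: powr_diff)
    ultimately have "q * (m powr q * K) \<le> J + (q - 1) * (m powr q * K)"
      by (simp add: mult.assoc)
    then have "m powr q * K \<le> J" by (simp add: left_diff_distrib)
    then have "K powr (q - 1) * (m powr q * K) \<le> K powr (q - 1) * J"
      by (intro mult_left_mono) auto
    moreover have "i powr q = K powr (q - 1) * (m powr q * K)"
      using m(1) K unfolding m(2) by (simp add: powr_diff powr_mult)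
    ultimately show ?thesis by simp
  qed (use real in auto)
  then show ?thesis
    using i K unfolding I_def[symmetric] real
    by (simp add: ennreal_powr_ennreal ennreal_leI real flip: ennreal_mult)
qed

section \<open>Null spheres and sigma-finiteness\<close>

text \<open>Apply the polar formula to the indicator of \<open>E\<close>: the inner integral
  vanishes at every radius other than \<open>r\<close>, and a single radius is Lebesgue null. Finite
  measure makes the indicator integrable. The choice \<open>r = 0\<close> covers
  \<open>{a}\<close>.\<close>

lemma polar_emeasure_sphere_subset:
  fixes \<mu> :: "'a::metric_space measure"
  assumes sets: "sets \<mu> = sets borel" and "has_polar_decomposition \<mu> a"
    and E: "E \<in> sets \<mu>" "E \<subseteq> sphere a r" "emeasure \<mu> E < \<infinity>"
  shows "emeasure \<mu> E = 0"
proof -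
  obtain \<sigma> lam where \<sigma>: "\<And>s. 0 < s \<Longrightarrow> sets (\<sigma> s) = sets (restrict_space borel (sphere a s))"
    and polar: "\<And>f :: 'a \<Rightarrow> complex. integrable \<mu> f \<Longrightarrow>
      (LINT x|\<mu>. f x) = (LINT s:{0<..}|lebesgue. (LINT x|\<sigma> s. f x * of_real (lam x)))"
    using assms(2) unfolding has_polar_decomposition_def polar_decomposition_def by blast
  have "(LINT x|\<sigma> s. indicator E x * complex_of_real (lam x)) = 0" if "0 < s" "s \<noteq> r" for s
  proof -
    have "space (\<sigma> s) = sphere a s"
      using sets_eq_imp_space_eq[OF \<sigma>[OF that(1)]] by (simp add: space_restrict_space)
    then have "(LINT x|\<sigma> s. indicator E x * complex_of_real (lam x)) = (LINT x|\<sigma> s. 0)"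
      using that(2) E(2) by (intro Bochner_Integration.integral_cong) (auto simp: indicator_def)
    then show ?thesis by simp
  qed
  moreover have "AE s in lebesgue. s \<noteq> r"
    by (rule AE_completion) (rule AE_lborel_singleton)
  ultimately have "(LINT s:{0<..}|lebesgue. (LINT x|\<sigma> s. indicator E x * complex_of_real (lam x))) = 0"
    unfolding set_lebesgue_integral_def
    by (intro integral_eq_zero_AE) (auto elim!: eventually_mono simp: indicator_def)
  moreover have "integrable \<mu> (indicator E :: 'a \<Rightarrow> complex)"
    using integrable_of_real[OF integrable_real_indicator[OF E(1,3)], where 'a=complex]
    by (simp add: of_real_indicator)
  ultimately have "(LINT x|\<mu>. indicator E x :: complex) = 0"
    using polar[of "indicator E"] by simp
  moreover have "(LINT x|\<mu>. indicator E x :: complex) = of_real (measure \<mu> E)"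
    using integral_of_real[OF integrable_real_indicator[OF E(1,3)], where 'a=complex]
    by (simp add: of_real_indicator Int_absorb2[OF sets.sets_into_space[OF E(1)]])
  \<comment> \<open>A zero \<open>measure\<close> could also stem from infinite mass, which
    finiteness of \<open>E\<close> rules out.\<close>
  ultimately show ?thesis
    using E(3) by (auto simp: measure_def enn2real_eq_0_iff)
qed

text \<open>Singletons are compact, so \<open>v\<close> is integrable over \<open>{a}\<close>. The
  polar formula speaks only of integrable functions and cannot by itself exclude an atom of infinite
  mass.\<close>

lemma locally_integrable_pos_emeasure_singleton_finite:
  fixes \<mu> :: "'a::metric_space measure"
  assumes sets: "sets \<mu> = sets borel" and "AE x in \<mu>. 0 < v x" and v: "locally_integrable \<mu> v"
  shows "emeasure \<mu> {a} < \<infinity>"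
proof (rule ccontr)
  assume "\<not> emeasure \<mu> {a} < \<infinity>"
  then have top: "emeasure \<mu> {a} = \<infinity>" by (metis infinity_ennreal_def less_top)
  have [measurable]: "{a} \<in> sets \<mu>" by (simp add: sets)
  \<comment> \<open>A point of infinite mass cannot lie in the null set where positivity of
    \<open>v\<close> fails.\<close>
  have "0 < v a"
  proof (rule ccontr)
    assume "\<not> 0 < v a"
    then have "AE x in \<mu>. x \<notin> {a}"
      using assms(2) by (auto elim: eventually_mono)
    then have "emeasure \<mu> {a} = 0"
      using AE_iff_measurable[of "{a}" \<mu> "\<lambda>x. x \<notin> {a}"] sets_eq_imp_space_eq[OF sets] by simp
    then show False using top by simp
  qed
  have "set_integrable \<mu> {a} v" using v by (simp add: locally_integrable_def)
  then have "(\<integral>\<^sup>+x. ennreal (norm (indicator {a} x *\<^sub>R v x)) \<partial>\<mu>) < \<infinity>"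
    by (simp add: set_integrable_def integrable_iff_bounded)
  also have "(\<integral>\<^sup>+x. ennreal (norm (indicator {a} x *\<^sub>R v x)) \<partial>\<mu>)
      = (\<integral>\<^sup>+x. ennreal \<bar>v a\<bar> * indicator {a} x \<partial>\<mu>)"
    by (intro nn_integral_cong) (auto simp: indicator_def)
  also have "\<dots> = \<infinity>"
    using top \<open>0 < v a\<close> by (subst nn_integral_cmult_indicator) (auto simp: ennreal_mult_top)
  finally show False by simp
qed

text \<open>By Markov's inequality each set where \<open>u\<close> is at least
  \<open>1 / (n + 1)\<close> has finite measure; together with the null set where \<open>u\<close>
  is not positive, these sets cover the space.\<close>

lemma sigma_finite_measureI_pos_integrable:
  fixes u :: "'a \<Rightarrow> real"
  assumes u: "integrable M u" and pos: "AE x in M. 0 < u x"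
  shows "sigma_finite_measure M"
proof
  have [measurable]: "u \<in> borel_measurable M" using u by auto
  define E where "E n = {x\<in>space M. 1 / real (Suc n) \<le> u x}" for n
  define Z where "Z = {x\<in>space M. \<not> 0 < u x}"
  have "emeasure M (E n) \<noteq> \<infinity>" for n
  proof -
    have "E n \<subseteq> {x\<in>space M. 1 \<le> ennreal (Suc n) * ennreal (u x)} \<inter> space M"
    proof
      fix x assume "x \<in> E n"
      then have "1 \<le> real (Suc n) * u x" "x \<in> space M"
        by (auto simp: E_def field_simps)
      then show "x \<in> {x\<in>space M. 1 \<le> ennreal (Suc n) * ennreal (u x)} \<inter> space M"
        by (auto simp flip: ennreal_mult' simp: ennreal_ge_1 simp del: of_nat_Suc)
    qed
    then have "emeasure M (E n) \<le> emeasure M ({x\<in>space M. 1 \<le> ennreal (Suc n) * ennreal (u x)} \<inter> space M)"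
      by (intro emeasure_mono) auto
    also have "\<dots> \<le> ennreal (Suc n) * (\<integral>\<^sup>+x. ennreal (u x) * indicator (space M) x \<partial>M)"
      using nn_integral_Markov_inequality[of "\<lambda>x. ennreal (u x)" "space M" M "ennreal (Suc n)"]
      by (simp add: Int_def conj_commute)
    also have "(\<integral>\<^sup>+x. ennreal (u x) * indicator (space M) x \<partial>M) = (\<integral>\<^sup>+x. ennreal (u x) \<partial>M)"
      by (intro nn_integral_cong) auto
    also have "\<dots> < \<infinity>"
      using u by (simp add: real_integrable_def less_top)
    then have "ennreal (Suc n) * (\<integral>\<^sup>+x. ennreal (u x) \<partial>M) < \<infinity>"
      by (simp add: ennreal_mult_less_top)
    finally show ?thesis by simp
  qed
  moreover have Es: "E n \<in> sets M" for n unfolding E_def by measurable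
  moreover have Z: "Z \<in> sets M" unfolding Z_def by measurable
  moreover have "emeasure M Z = 0"
    using pos Z by (subst (asm) AE_iff_measurable[of Z]) (auto simp only: Z_def)
  moreover have "(\<Union>n. E n) \<union> Z = space M"
  proof -
    have "x \<in> (\<Union>n. E n)" if x: "x \<in> space M" "0 < u x" for x
    proof -
      obtain n where "1 / real (Suc n) < u x" using nat_approx_posE[OF x(2)] .
      then have "x \<in> E n" using x(1) unfolding E_def by simp
      then show ?thesis by blast
    qed
    then show ?thesis unfolding E_def Z_def by blast
  qed
  ultimately show "\<exists>A. countable A \<and> A \<subseteq> sets M \<and> \<Union>A = space M \<and> (\<forall>a\<in>A. emeasure M a \<noteq> \<infinity>)"
    by (intro exI[of _ "insert Z (range E)"]) auto
qed

text \<open>A sphere might a priori have infinite measure, so it is cut into countably many pieces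
  of finite measure.\<close>

lemma polar_emeasure_sphere:
  fixes \<mu> :: "'a::metric_space measure"
  assumes "sigma_finite_measure \<mu>" and sets: "sets \<mu> = sets borel"
    and "has_polar_decomposition \<mu> a"
  shows "sphere a r \<in> null_sets \<mu>"
proof -
  interpret sigma_finite_measure \<mu> by fact
  obtain A :: "nat \<Rightarrow> 'a set" where A: "range A \<subseteq> sets \<mu>" "(\<Union>i. A i) = space \<mu>"
    "\<And>i. emeasure \<mu> (A i) \<noteq> \<infinity>"
    using sigma_finite by blast
  have S: "sphere a r \<in> sets \<mu>" 
    unfolding sets sphere_def by (intro borel_closed closed_Collect_eq continuous_intros)
  have "A i \<inter> sphere a r \<in> null_sets \<mu>" for i
  proof -
    have E: "A i \<inter> sphere a r \<in> sets \<mu>" using A(1) S by auto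
    have "emeasure \<mu> (A i \<inter> sphere a r) \<le> emeasure \<mu> (A i)"
      using A(1) by (intro emeasure_mono) auto
    also have "\<dots> < \<infinity>" using A(3) by (simp add: less_top)
    finally show ?thesis
      using polar_emeasure_sphere_subset[OF sets assms(3) E] E by auto
  qed
  then have "(\<Union>i. A i \<inter> sphere a r) \<in> null_sets \<mu>" by (rule null_sets_UN)
  also have "(\<Union>i. A i \<inter> sphere a r) = sphere a r"
    using A(2) sets.sets_into_space[OF S] by blast
  finally show ?thesis .
qed

section \<open>The weighted inequality for an abstract radius function\<close>

text \<open>\<open>\<rho>\<close> stands for the distance to the centre, and \<open>A\<close> may be
  \<open>0\<close> or \<open>top\<close>. The tail in \<open>bound\<close> contains the level
  \<open>\<rho> x = \<rho> z\<close>, because exchanging the integrals keeps the relation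
  \<open>\<rho> z \<le> \<rho> x\<close> and only changes the variable of integration.\<close>

lemma nn_integral_hardy:
  fixes \<rho> v :: "'a \<Rightarrow> real" and g u :: "'a \<Rightarrow> ennreal"
  assumes M: "sigma_finite_measure M"
    and [measurable]: "\<rho> \<in> borel_measurable M" "v \<in> borel_measurable M"
      "g \<in> borel_measurable M" "u \<in> borel_measurable M"
    and q: "1 \<le> q" and v: "AE z in M. 0 < v z"
    and bound: "AE z in M. ennreal_powr (\<integral>\<^sup>+x\<in>{x. \<rho> z \<le> \<rho> x}. u x \<partial>M) (1 / q) \<le> A * ennreal (v z)"
  shows "ennreal_powr (\<integral>\<^sup>+x. ennreal_powr (\<integral>\<^sup>+z\<in>{z. \<rho> z \<le> \<rho> x}. g z \<partial>M) q * u x \<partial>M) (1 / q)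
    \<le> A * (\<integral>\<^sup>+z. g z * ennreal (v z) \<partial>M)"
proof -
  interpret sigma_finite_measure M by (rule M)
  interpret pair_sigma_finite M M ..
  \<comment> \<open>The common kernel of both inner integrals: \<open>F\<close> integrates it over
    \<open>z\<close>, \<open>U\<close> over \<open>x\<close>.\<close>
  define I where "I z x = (if \<rho> z \<le> \<rho> x then 1 else 0 :: ennreal)" for z x
  have [measurable]: "case_prod I \<in> borel_measurable (M \<Otimes>\<^sub>M M)"
    unfolding I_def by measurable
  have [measurable]: "I z \<in> borel_measurable M" "(\<lambda>x. I x z) \<in> borel_measurable M" for z
    unfolding I_def by measurable
  define F where "F x = (\<integral>\<^sup>+z. g z * I z x \<partial>M)" for x
  define U where "U z = (\<integral>\<^sup>+x. u x * I z x \<partial>M)" for z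
  define K where "K = (\<integral>\<^sup>+z. g z * ennreal (v z) \<partial>M)"
  have [measurable]: "F \<in> borel_measurable M" "U \<in> borel_measurable M"
    unfolding F_def U_def by measurable
  have F: "(\<integral>\<^sup>+z\<in>{z. \<rho> z \<le> \<rho> x}. g z \<partial>M) = F x" for x
    unfolding F_def I_def by (intro nn_integral_cong) (auto simp: indicator_def)
  have "(\<integral>\<^sup>+x\<in>{x. \<rho> z \<le> \<rho> x}. u x \<partial>M) = U z" for z
    unfolding U_def I_def by (intro nn_integral_cong) (auto simp: indicator_def)
  then have U: "AE z in M. ennreal_powr (U z) (1 / q) \<le> A * ennreal (v z)"
    using bound by simp
  have U': "AE z in M. U z \<le> ennreal_powr (A * ennreal (v z)) q"
    using U
  proof eventually_elim
    case (elim z)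
    \<comment> \<open>The exponent \<open>q\<close> is written \<open>1 / (1 / q)\<close> so that
      the cancellation rule applies with \<open>p = 1 / q\<close>.\<close>
    then have "ennreal_powr (ennreal_powr (U z) (1 / q)) (1 / (1 / q))
        \<le> ennreal_powr (A * ennreal (v z)) (1 / (1 / q))"
      using q by (intro ennreal_powr_mono) auto
    then show ?case using q by (subst (asm) ennreal_powr_cancel) auto
  qed
  \<comment> \<open>Since \<open>0 * top = 0\<close>, the right-hand side can vanish while one
    factor is infinite. Only the last case, with both factors positive and real, needs Jensen's
    inequality.\<close>
  consider "A * K = top" | "A = 0" | "K = 0"
    | c K' where "A = ennreal c" "0 < c" "K = ennreal K'" "0 < K'"
    by (cases "A = 0"; cases "K = 0"; cases A rule: ennreal_cases; cases K rule: ennreal_cases)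
      (auto simp: ennreal_mult_top ennreal_top_mult less_le)
  then have "ennreal_powr (\<integral>\<^sup>+x. ennreal_powr (F x) q * u x \<partial>M) (1 / q) \<le> A * K"
  proof cases
    case 2
    have "(\<integral>\<^sup>+x. F x * u x \<partial>M) = (\<integral>\<^sup>+x. \<integral>\<^sup>+z. u x * (g z * I z x) \<partial>M \<partial>M)"
      unfolding F_def by (simp add: nn_integral_cmult mult.commute)
    also have "\<dots> = (\<integral>\<^sup>+z. \<integral>\<^sup>+x. u x * (g z * I z x) \<partial>M \<partial>M)"
      by (subst Fubini') auto
    also have "\<dots> = (\<integral>\<^sup>+z. g z * U z \<partial>M)"
      unfolding U_def by (auto simp flip: nn_integral_cmult intro!: nn_integral_cong simp: mult_ac)
    also have "\<dots> = (\<integral>\<^sup>+z. 0 \<partial>M)"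
      using U' 2 by (intro nn_integral_cong_AE) (auto elim!: eventually_mono)
    finally have "AE x in M. F x * u x = 0"
      by (subst (asm) nn_integral_const, subst (asm) mult_zero_left,
          subst (asm) nn_integral_0_iff_AE) auto
    then have "(\<integral>\<^sup>+x. ennreal_powr (F x) q * u x \<partial>M) = (\<integral>\<^sup>+x. 0 \<partial>M)"
      by (intro nn_integral_cong_AE) (auto elim!: eventually_mono)
    then show ?thesis by simp
  next
    case 3
    then have "AE z in M. g z * ennreal (v z) = 0"
      unfolding K_def by (subst (asm) nn_integral_0_iff_AE) auto
    with v have "AE z in M. g z = 0"
      by eventually_elim auto
    then have "F x = (\<integral>\<^sup>+z. 0 \<partial>M)" for x
      unfolding F_def by (intro nn_integral_cong_AE) (auto elim!: eventually_mono)
    then show ?thesis by simp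
  next
    case (4 c K')
    \<comment> \<open>\<open>k\<close> is the density of total mass \<open>K'\<close>, and
      \<open>h x\<close> is \<open>1 / v\<close> cut off at the radius of \<open>x\<close>, so that
      \<open>F x\<close> is the \<open>k\<close>-integral of \<open>h x\<close>. The test
      \<open>0 < v z\<close> keeps \<open>h\<close> nonnegative on the exceptional null set.\<close>
    define k where "k z = g z * ennreal (v z)" for z
    define h where "h x z = (if 0 < v z \<and> \<rho> z \<le> \<rho> x then 1 / v z else 0)" for x z
    have [measurable]: "k \<in> borel_measurable M" "case_prod h \<in> borel_measurable (M \<Otimes>\<^sub>M M)"
      "\<And>x. h x \<in> borel_measurable M" "\<And>z. (\<lambda>x. h x z) \<in> borel_measurable M"
      unfolding k_def h_def by measurable
    have h0: "0 \<le> h x z" for x z by (simp add: h_def)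
    have "F x = (\<integral>\<^sup>+z. ennreal (h x z) * k z \<partial>M)" for x
      unfolding F_def
    proof (rule nn_integral_cong_AE, use v in eventually_elim)
      case (elim z)
      then have "ennreal (1 / v z) * ennreal (v z) = 1"
        by (simp flip: ennreal_mult)
      then show ?case
        using elim by (simp add: h_def I_def k_def mult.left_commute[of _ "g z"])
    qed
    moreover have "(\<integral>\<^sup>+z. k z \<partial>M) = ennreal K'" using 4 by (simp add: K_def k_def)
    ultimately have jensen: "ennreal_powr (F x) q
        \<le> ennreal (K' powr (q - 1)) * (\<integral>\<^sup>+z. ennreal (h x z powr q) * k z \<partial>M)" for x
      using nn_integral_powr_jensen[of "h x" M k q K'] h0 q 4 by simp
    \<comment> \<open>The weight condition enters here: it bounds
      \<open>(1 / v z) powr q * U z\<close> by \<open>c powr q\<close>, uniformly in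
      \<open>z\<close>.\<close>
    have inner: "AE z in M. k z * (\<integral>\<^sup>+x. ennreal (h x z powr q) * u x \<partial>M) \<le> k z * ennreal (c powr q)"
      using v U'
    proof eventually_elim
      case (elim z)
      have "(\<integral>\<^sup>+x. ennreal (h x z powr q) * u x \<partial>M) = (\<integral>\<^sup>+x. ennreal ((1 / v z) powr q) * (u x * I z x) \<partial>M)"
        using elim by (intro nn_integral_cong) (auto simp: h_def I_def)
      also have "\<dots> = ennreal ((1 / v z) powr q) * U z"
        unfolding U_def by (rule nn_integral_cmult) measurable
      also have "\<dots> \<le> ennreal ((1 / v z) powr q) * ennreal_powr (ennreal c * ennreal (v z)) q"
        using elim 4 by (intro mult_left_mono) auto
      also have "ennreal_powr (ennreal c * ennreal (v z)) q = ennreal ((c * v z) powr q)"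
        using elim 4 by (simp add: ennreal_powr_ennreal flip: ennreal_mult)
      also have "ennreal ((1 / v z) powr q) * ennreal ((c * v z) powr q) = ennreal (c powr q)"
        using elim 4 by (simp add: powr_mult[symmetric] flip: ennreal_mult)
      finally show ?case by (intro mult_left_mono) auto
    qed
    \<comment> \<open>Jensen's inequality is used for each \<open>x\<close>; Tonelli's theorem then
      moves the \<open>x\<close>-integral inside, where \<open>inner\<close> applies.\<close>
    have "(\<integral>\<^sup>+x. ennreal_powr (F x) q * u x \<partial>M)
        \<le> (\<integral>\<^sup>+x. ennreal (K' powr (q - 1)) * (\<integral>\<^sup>+z. ennreal (h x z powr q) * k z \<partial>M) * u x \<partial>M)"
      by (intro nn_integral_mono mult_right_mono jensen) auto
    also have "\<dots> = (\<integral>\<^sup>+x. ennreal (K' powr (q - 1)) * (\<integral>\<^sup>+z. k z * (ennreal (h x z powr q) * u x) \<partial>M) \<partial>M)"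
      by (intro nn_integral_cong, subst mult.assoc, subst nn_integral_multc[symmetric])
        (auto simp: mult_ac)
    also have "\<dots> = ennreal (K' powr (q - 1)) * (\<integral>\<^sup>+x. \<integral>\<^sup>+z. k z * (ennreal (h x z powr q) * u x) \<partial>M \<partial>M)"
      by (rule nn_integral_cmult) measurable
    also have "(\<integral>\<^sup>+x. \<integral>\<^sup>+z. k z * (ennreal (h x z powr q) * u x) \<partial>M \<partial>M)
        = (\<integral>\<^sup>+z. \<integral>\<^sup>+x. k z * (ennreal (h x z powr q) * u x) \<partial>M \<partial>M)"
      by (subst Fubini') auto
    also have "\<dots> = (\<integral>\<^sup>+z. k z * (\<integral>\<^sup>+x. ennreal (h x z powr q) * u x \<partial>M) \<partial>M)"
      by (intro nn_integral_cong nn_integral_cmult) measurable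
    also have "\<dots> \<le> (\<integral>\<^sup>+z. k z * ennreal (c powr q) \<partial>M)"
      by (rule nn_integral_mono_AE[OF inner])
    also have "\<dots> = ennreal K' * ennreal (c powr q)"
      using 4 by (simp add: nn_integral_multc K_def k_def)
    also have "ennreal (K' powr (q - 1)) * (ennreal K' * ennreal (c powr q)) = ennreal_powr (A * K) q"
      using 4 by (simp add: ennreal_powr_ennreal powr_mult powr_diff flip: ennreal_mult)
    finally have "(\<integral>\<^sup>+x. ennreal_powr (F x) q * u x \<partial>M) \<le> ennreal_powr (A * K) q"
      by (simp add: mult_left_mono)
    then have "ennreal_powr (\<integral>\<^sup>+x. ennreal_powr (F x) q * u x \<partial>M) (1 / q)
        \<le> ennreal_powr (ennreal_powr (A * K) q) (1 / q)"
      using q by (intro ennreal_powr_mono) auto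
    then show ?thesis using q by (simp add: ennreal_powr_cancel)
  qed simp
  then show ?thesis unfolding F K_def .
qed

section \<open>From integral bounds to bounds almost everywhere\<close>

text \<open>Test on the part of \<open>B\<close> where \<open>g x < W\<close>, inside a piece of
  finite measure: were it not null, the integral of \<open>g\<close> over it would be strictly below
  \<open>W\<close> times its measure. Finiteness of \<open>W\<close> keeps these integrals finite,
  as strictness requires.\<close>

lemma AE_le_if_nn_integral_le:
  fixes g :: "'a \<Rightarrow> ennreal"
  assumes M: "sigma_finite_measure M" and [measurable]: "g \<in> borel_measurable M" "B \<in> sets M"
    and "W < top"
    and le: "\<And>E. E \<in> sets M \<Longrightarrow> E \<subseteq> B \<Longrightarrow> emeasure M E < top \<Longrightarrow> W * emeasure M E \<le> (\<integral>\<^sup>+x\<in>E. g x \<partial>M)"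
  shows "AE x in M. x \<in> B \<longrightarrow> W \<le> g x"
proof -
  interpret sigma_finite_measure M by (rule M)
  obtain A :: "nat \<Rightarrow> 'a set" where A: "range A \<subseteq> sets M" "(\<Union>i. A i) = space M"
    "\<And>i. emeasure M (A i) \<noteq> \<infinity>"
    using sigma_finite by blast
  have "AE x in M. x \<in> A i \<longrightarrow> x \<in> B \<longrightarrow> W \<le> g x" for i
  proof (rule ccontr)
    assume neg: "\<not> (AE x in M. x \<in> A i \<longrightarrow> x \<in> B \<longrightarrow> W \<le> g x)"
    have [measurable]: "A i \<in> sets M" using A(1) by auto
    define E where "E = {x\<in>space M. x \<in> A i \<and> x \<in> B \<and> g x < W}"
    have [measurable]: "E \<in> sets M" unfolding E_def by measurable
    have "emeasure M E \<le> emeasure M (A i)" by (intro emeasure_mono) (auto simp: E_def)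
    also have "\<dots> < top" using A(3) by (simp add: less_top)
    finally have fin: "emeasure M E < top" .
    have mono: "g x * indicator E x \<le> W * indicator E x" for x
      by (auto simp: E_def indicator_def)
    have WE: "(\<integral>\<^sup>+x\<in>E. W \<partial>M) = W * emeasure M E"
      by (rule nn_integral_cmult_indicator) measurable
    have "(\<integral>\<^sup>+x\<in>E. g x \<partial>M) < (\<integral>\<^sup>+x\<in>E. W \<partial>M)"
    proof (rule nn_integral_less)
      have "(\<integral>\<^sup>+x\<in>E. g x \<partial>M) \<le> W * emeasure M E"
        unfolding WE[symmetric] by (intro nn_integral_mono mono)
      also have "\<dots> < top" using fin \<open>W < top\<close> by (simp add: ennreal_mult_less_top)
      finally show "(\<integral>\<^sup>+x\<in>E. g x \<partial>M) \<noteq> \<infinity>" by simp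
      show "\<not> (AE x in M. W * indicator E x \<le> g x * indicator E x)"
      proof
        assume "AE x in M. W * indicator E x \<le> g x * indicator E x"
        then have "AE x in M. x \<in> A i \<longrightarrow> x \<in> B \<longrightarrow> W \<le> g x"
          using AE_space by eventually_elim (auto simp: E_def not_less[symmetric])
        with neg show False by simp
      qed
    qed (use mono in auto)
    moreover have "W * emeasure M E \<le> (\<integral>\<^sup>+x\<in>E. g x \<partial>M)"
      using fin by (intro le) (auto simp: E_def)
    ultimately show False using WE by simp
  qed
  then have "AE x in M. \<forall>i. x \<in> A i \<longrightarrow> x \<in> B \<longrightarrow> W \<le> g x"
    by (subst AE_all_countable) blast
  then show ?thesis
    using AE_space by eventually_elim (use A(2) in blast)
qed

section \<open>Sufficiency and optimality of the Hardy constant\<close>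

context
  fixes \<mu> :: "'a::metric_space measure" and a :: 'a and q :: real and u v :: "'a \<Rightarrow> real"
  assumes sets [measurable_cong]: "sets \<mu> = sets borel"
    and q: "1 \<le> q"
    and u [measurable]: "u \<in> borel_measurable \<mu>" and v [measurable]: "v \<in> borel_measurable \<mu>"
    and vpos: "AE x in \<mu>. 0 < v x"
    and \<mu>: "sigma_finite_measure \<mu>"
begin

text \<open>For fixed \<open>R\<close> the supremum bounds the tail beyond \<open>R\<close> for
  almost all \<open>z\<close> in the ball. Letting rational \<open>R\<close> decrease to
  \<open>dist z a\<close> gives the pointwise hypothesis of \<open>nn_integral_hardy\<close>. The
  constant may be \<open>top\<close>.\<close>

lemma hardy_inequality_hardy_constant:
  assumes f [measurable]: "f \<in> borel_measurable \<mu>"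
    and sphere: "\<And>r. sphere a r \<in> null_sets \<mu>"
  shows "hardy_inequality \<mu> a q u v (hardy_constant \<mu> a q u v) f"
proof -
  define A where "A = hardy_constant \<mu> a q u v"
  define U where "U R = (\<integral>\<^sup>+y\<in>- cball a R. ennreal (u y) \<partial>\<mu>)" for R
  have cball [measurable]: "cball a R \<in> sets \<mu>" "- cball a R \<in> sets \<mu>" for R
    unfolding sets by (auto intro: borel_closed borel_open simp: open_Compl)
  have U_density: "U R = emeasure (density \<mu> u) (- cball a R)" for R
    unfolding U_def by (subst emeasure_density) auto
  have AE_R: "AE z in \<mu>. dist z a \<le> R \<longrightarrow> ennreal_powr (U R) (1 / q) \<le> A * ennreal (v z)"
    if "0 < R" for R
  proof -
    have "ennreal_powr (U R) (1 / q) * esssup (restrict_space \<mu> (cball a R)) (\<lambda>y. inverse (ennreal (v y))) \<le> A"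
      unfolding A_def hardy_constant_def U_def using that by (intro SUP_upper) auto
    moreover have "AE z in \<mu>. z \<in> cball a R \<longrightarrow>
        inverse (ennreal (v z)) \<le> esssup (restrict_space \<mu> (cball a R)) (\<lambda>y. inverse (ennreal (v y)))"
      using esssup_AE[of "\<lambda>y. inverse (ennreal (v y))" "restrict_space \<mu> (cball a R)"] cball(1)[of R]
      by (subst (asm) AE_restrict_space_iff) (auto simp: sets.Int_space_eq2)
    ultimately have "AE z in \<mu>. z \<in> cball a R \<longrightarrow> ennreal_powr (U R) (1 / q) * inverse (ennreal (v z)) \<le> A"
      by (elim eventually_mono) (meson mult_left_mono order_trans zero_le)
    with vpos show ?thesis
    proof eventually_elim
      case (elim z)
      show ?case
      proof
        assume "dist z a \<le> R"
        then have "ennreal_powr (U R) (1 / q) * inverse (ennreal (v z)) * ennreal (v z) \<le> A * ennreal (v z)"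
          using elim by (intro mult_right_mono) (auto simp: dist_commute)
        moreover have "inverse (ennreal (v z)) * ennreal (v z) = 1"
          using elim by (simp add: inverse_ennreal flip: ennreal_mult)
        ultimately show "ennreal_powr (U R) (1 / q) \<le> A * ennreal (v z)"
          by (simp add: mult.assoc)
      qed
    qed
  qed
  text \<open>Right continuity is needed because the null sets in
    \<open>AE_R\<close> depend on \<open>R\<close>: only countably many \<open>R\<close> can be used at once.\<close>
  have U_right: "U s = (SUP n. U (s + 1 / real (Suc n)))" for s
  proof -
    have "(SUP n. emeasure (density \<mu> u) (- cball a (s + 1 / real (Suc n))))
        = emeasure (density \<mu> u) (\<Union>n. - cball a (s + 1 / real (Suc n)))"
    proof (rule SUP_emeasure_incseq)
      show "incseq (\<lambda>n. - cball a (s + 1 / real (Suc n)))"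
        unfolding incseq_def
      proof (intro allI impI)
        fix m n :: nat assume "m \<le> n"
        then have "1 / real (Suc n) \<le> 1 / real (Suc m)" by (intro frac_le) auto
        then show "- cball a (s + 1 / real (Suc m)) \<subseteq> - cball a (s + 1 / real (Suc n))"
          by (auto simp del: of_nat_Suc)
      qed
    qed (use cball in auto)
    moreover have "(\<Union>n. - cball a (s + 1 / real (Suc n))) = - cball a s"
    proof (intro set_eqI iffI)
      fix x assume "x \<in> - cball a s"
      then have "0 < dist a x - s" by simp
      from nat_approx_posE[OF this] obtain n where "1 / real (Suc n) < dist a x - s" .
      then show "x \<in> (\<Union>n. - cball a (s + 1 / real (Suc n)))"
        by (auto simp: not_le intro!: exI[of _ n])
    next
      fix x assume "x \<in> (\<Union>n. - cball a (s + 1 / real (Suc n)))"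
      then obtain n where "s + 1 / real (Suc n) < dist a x" by (auto simp: not_le)
      moreover have "0 < 1 / real (Suc n)" by simp
      ultimately have "s < dist a x" by linarith
      then show "x \<in> - cball a s" by simp
    qed
    ultimately show ?thesis by (simp add: U_density)
  qed
  have U_antimono: "U R' \<le> U R" if "R \<le> R'" for R R'
    unfolding U_def using that by (intro nn_integral_mono) (auto simp: indicator_def)
  \<comment> \<open>The Hardy constant uses the tail outside the closed ball, the exchange of
    integrals the tail including the sphere; they differ by a null set.\<close>
  have U_closed: "(\<integral>\<^sup>+x\<in>{x. s \<le> dist x a}. ennreal (u x) \<partial>\<mu>) = U s" for s
    unfolding U_def
  proof (rule nn_integral_cong_AE, use AE_not_in[OF sphere[of s]] in eventually_elim)
    case (elim x)
    then show ?case by (auto simp: indicator_def dist_commute)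
  qed
  have "AE z in \<mu>. \<forall>R\<in>\<rat>. 0 < R \<longrightarrow> dist z a \<le> R \<longrightarrow> ennreal_powr (U R) (1 / q) \<le> A * ennreal (v z)"
    using AE_R by (subst AE_ball_countable) (auto simp: countable_rat)
  then have bound: "AE z in \<mu>. ennreal_powr (\<integral>\<^sup>+x\<in>{x. dist z a \<le> dist x a}. ennreal (u x) \<partial>\<mu>) (1 / q)
      \<le> A * ennreal (v z)"
  proof eventually_elim
    case (elim z)
    let ?s = "dist z a" and ?B = "ennreal_powr (A * ennreal (v z)) q"
    have "U (?s + 1 / real (Suc n)) \<le> ?B" for n
    proof -
      \<comment> \<open>A radius strictly above \<open>?s\<close> has \<open>z\<close> in its ball
        and is positive even when \<open>z = a\<close>, so the bound over the rationals applies to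
        it.\<close>
      obtain R where R: "R \<in> \<rat>" "?s < R" "R < ?s + 1 / real (Suc n)"
        using Rats_dense_in_real[of ?s "?s + 1 / real (Suc n)"] by auto
      then have "0 < R" using zero_le_dist[of z a] by linarith
      have "U (?s + 1 / real (Suc n)) \<le> U R" using R by (intro U_antimono) simp
      also have "U R = ennreal_powr (ennreal_powr (U R) (1 / q)) (1 / (1 / q))"
        using q by (subst ennreal_powr_cancel) auto
      also have "\<dots> \<le> ?B"
        using q elim R \<open>0 < R\<close> by (auto intro!: ennreal_powr_mono)
      finally show ?thesis .
    qed
    then have "U ?s \<le> ?B" by (subst U_right) (rule SUP_least)
    then have "ennreal_powr (U ?s) (1 / q) \<le> ennreal_powr ?B (1 / q)"
      using q by (intro ennreal_powr_mono) auto
    then show ?case unfolding U_closed using q by (simp add: ennreal_powr_cancel)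
  qed
  have [measurable]: "(\<lambda>x. dist x a) \<in> borel_measurable \<mu>"
    unfolding measurable_cong_sets[OF sets refl]
    by (intro borel_measurable_continuous_onI continuous_intros)
  have cball_eq: "cball a r = {z. dist z a \<le> r}" for r
    by (auto simp: dist_commute)
  show ?thesis
    unfolding hardy_inequality_def A_def[symmetric] cball_eq
    using \<mu> q vpos bound by (intro nn_integral_hardy) auto
qed

text \<open>Test with indicators of sets \<open>E\<close> of finite measure in the ball of radius
  \<open>R\<close>. Outside this ball the inner integral is the full measure of \<open>E\<close>, so
  the root of the tail times that measure is at most \<open>C\<close> times the integral of
  \<open>v\<close> over \<open>E\<close>. Arbitrary \<open>E\<close> turn this into a bound almost
  everywhere.\<close>

lemma hardy_constant_le:
  assumes int: "set_integrable \<mu> (- {a}) u"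
    and hardy: "\<And>f. f \<in> borel_measurable \<mu> \<Longrightarrow> hardy_inequality \<mu> a q u v C f"
  shows "hardy_constant \<mu> a q u v \<le> C"
proof (cases "C = top")
  case C: False
  have [measurable]: "cball a R \<in> sets \<mu>" "- cball a R \<in> sets \<mu>" for R
    unfolding sets by (auto intro: borel_closed borel_open simp: open_Compl)
  show ?thesis
    unfolding hardy_constant_def
  proof (rule SUP_least)
    fix R :: real assume "R \<in> {0<..}"
    then have R: "0 < R" by simp
    define U where "U = (\<integral>\<^sup>+y\<in>- cball a R. ennreal (u y) \<partial>\<mu>)"
    define W where "W = ennreal_powr U (1 / q)"
    \<comment> \<open>Since \<open>R\<close> is positive, the complement of the ball avoids
      \<open>a\<close>, so integrability of \<open>u\<close> off \<open>a\<close> makes the tail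
      finite.\<close>
    have "U \<le> (\<integral>\<^sup>+y. ennreal (norm (indicator (- {a}) y *\<^sub>R u y)) \<partial>\<mu>)"
      unfolding U_def using R by (intro nn_integral_mono) (auto simp: indicator_def intro!: ennreal_leI)
    also have "\<dots> < top"
      using int by (simp add: set_integrable_def integrable_iff_bounded)
    finally have "W < top" by (simp add: W_def ennreal_powr_def)
    \<comment> \<open>For \<open>W = 0\<close> the product is zero even if the essential supremum is
      \<open>top\<close>; otherwise division by \<open>W\<close> is possible.\<close>
    consider "W = 0" | "0 < W" by (auto simp: zero_less_iff_neq_zero)
    then show "ennreal_powr (\<integral>\<^sup>+y\<in>- cball a R. ennreal (u y) \<partial>\<mu>) (1 / q)
        * esssup (restrict_space \<mu> (cball a R)) (\<lambda>y. inverse (ennreal (v y))) \<le> C"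
      unfolding W_def[symmetric] U_def[symmetric]
    proof cases
      case 2
      have test: "W * emeasure \<mu> E \<le> (\<integral>\<^sup>+x\<in>E. C * ennreal (v x) \<partial>\<mu>)"
        if E: "E \<in> sets \<mu>" "E \<subseteq> cball a R" "emeasure \<mu> E < top" for E
      proof (cases "emeasure \<mu> E" rule: ennreal_cases)
        case (real e)
        have [measurable]: "E \<in> sets \<mu>" by fact
        show ?thesis
        proof (cases "e = 0")
          case False
          define f :: "'a \<Rightarrow> complex" where "f = indicator E"
          have f: "ennreal (norm (f x)) = indicator E x" for x by (simp add: f_def indicator_def)
          have "ennreal (e powr q) * U = (\<integral>\<^sup>+x. ennreal (e powr q) * (ennreal (u x) * indicator (- cball a R) x) \<partial>\<mu>)"
            unfolding U_def by (rule nn_integral_cmult[symmetric]) measurable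
          also have "\<dots> \<le> (\<integral>\<^sup>+x. ennreal_powr (\<integral>\<^sup>+z\<in>cball a (dist x a). ennreal (norm (f z)) \<partial>\<mu>) q * ennreal (u x) \<partial>\<mu>)"
          proof (rule nn_integral_mono)
            fix x
            show "ennreal (e powr q) * (ennreal (u x) * indicator (- cball a R) x)
              \<le> ennreal_powr (\<integral>\<^sup>+z\<in>cball a (dist x a). ennreal (norm (f z)) \<partial>\<mu>) q * ennreal (u x)"
            proof (cases "x \<in> cball a R")
              case x: False
              \<comment> \<open>\<open>E\<close> lies in the ball of radius \<open>R\<close>, which
                lies in the ball of radius \<open>dist x a\<close>.\<close>
              have "(\<integral>\<^sup>+z\<in>cball a (dist x a). ennreal (norm (f z)) \<partial>\<mu>) = (\<integral>\<^sup>+z. indicator E z \<partial>\<mu>)"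
                unfolding f using x E(2)
                by (intro nn_integral_cong) (auto simp: indicator_def dist_commute)
              then show ?thesis
                using x real by (simp add: ennreal_powr_ennreal)
            qed simp
          qed
          finally have "ennreal_powr (ennreal (e powr q) * U) (1 / q) \<le> ennreal_powr \<dots> (1 / q)"
            using q by (intro ennreal_powr_mono) auto
          also have "\<dots> \<le> C * (\<integral>\<^sup>+x. ennreal (norm (f x)) * ennreal (v x) \<partial>\<mu>)"
            using hardy[of f] unfolding hardy_inequality_def f_def by simp
          also have "\<dots> = (\<integral>\<^sup>+x\<in>E. C * ennreal (v x) \<partial>\<mu>)"
            unfolding f by (subst nn_integral_cmult[symmetric]) (auto simp: mult_ac)
          also have "ennreal_powr (ennreal (e powr q) * U) (1 / q) = W * emeasure \<mu> E"
            using False real q by (subst ennreal_powr_mult) (auto simp: W_def powr_powr mult.commute)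
          finally show ?thesis .
        qed (use real in simp)
      qed (use E in simp)
      have "AE x in \<mu>. x \<in> cball a R \<longrightarrow> W \<le> C * ennreal (v x)"
        using \<mu> \<open>W < top\<close> test by (intro AE_le_if_nn_integral_le) auto
      with vpos have AE: "AE x in \<mu>. x \<in> cball a R \<longrightarrow> inverse (ennreal (v x)) \<le> C / W"
      proof eventually_elim
        case (elim x)
        show ?case
        proof
          assume "x \<in> cball a R"
          then have le: "W \<le> C * ennreal (v x)" using elim by simp
          obtain w c where wc: "W = ennreal w" "0 < w" "C = ennreal c" "0 \<le> c"
            using \<open>W < top\<close> C 2 by (cases W rule: ennreal_cases; cases C rule: ennreal_cases) auto
          then have "w \<le> c * v x"
            using le elim(1) by (simp flip: ennreal_mult)
          then show "inverse (ennreal (v x)) \<le> C / W"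
            using wc elim(1) by (simp add: inverse_ennreal divide_ennreal field_simps)
        qed
      qed
      have "esssup (restrict_space \<mu> (cball a R)) (\<lambda>y. inverse (ennreal (v y))) \<le> C / W"
      proof (rule esssup_I)
        show "AE x in restrict_space \<mu> (cball a R). inverse (ennreal (v x)) \<le> C / W"
          using AE by (subst AE_restrict_space_iff) (auto simp: sets.Int_space_eq2)
      qed (intro measurable_restrict_space1, measurable)
      then have "W * esssup (restrict_space \<mu> (cball a R)) (\<lambda>y. inverse (ennreal (v y))) \<le> W * (C / W)"
        by (intro mult_left_mono) auto
      also have "\<dots> \<le> C"
        using \<open>W < top\<close> 2 by (simp add: ennreal_times_divide ennreal_mult_divide_eq mult.commute)
      finally show "W * esssup (restrict_space \<mu> (cball a R)) (\<lambda>y. inverse (ennreal (v y))) \<le> C" .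
    qed simp
  qed
qed simp

end

section \<open>Equivalence and best constant\<close>

theorem theorem3p1:
  fixes \<mu> :: "'a::metric_space measure" and a :: 'a
    and q :: real and u v :: "'a \<Rightarrow> real"
  assumes "sets \<mu> = sets borel"
    and "has_polar_decomposition \<mu> a"
    and "1 \<le> q"
    and "u \<in> borel_measurable \<mu>" and "v \<in> borel_measurable \<mu>"
    and "AE x in \<mu>. 0 < u x" and "AE x in \<mu>. 0 < v x"
    and "set_integrable \<mu> (- {a}) u"
    and "locally_integrable \<mu> v"
  shows "((\<exists>C<top. \<forall>f\<in>borel_measurable \<mu>. hardy_inequality \<mu> a q u v C f)
            \<longleftrightarrow> hardy_constant \<mu> a q u v < top) \<and>
         (hardy_constant \<mu> a q u v < top \<longrightarrow>
            (\<forall>f\<in>borel_measurable \<mu>. hardy_inequality \<mu> a q u v (hardy_constant \<mu> a q u v) f) \<and>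
            (\<forall>C. (\<forall>f\<in>borel_measurable \<mu>. hardy_inequality \<mu> a q u v C f)
                 \<longrightarrow> hardy_constant \<mu> a q u v \<le> C))"
proof -
  \<comment> \<open>The centre comes first: \<open>u\<close> is integrable only off
    \<open>a\<close>, so \<open>{a}\<close> must be null before \<open>u\<close> can witness
    sigma-finiteness, on which the nullity of all spheres then rests.\<close>
  have "{a} \<in> sets \<mu>" by (simp add: assms(1))
  moreover have "emeasure \<mu> {a} < \<infinity>"
    by (rule locally_integrable_pos_emeasure_singleton_finite[OF assms(1,7,9)])
  ultimately have "emeasure \<mu> {a} = 0"
    by (intro polar_emeasure_sphere_subset[OF assms(1,2), of _ 0]) auto
  with \<open>{a} \<in> sets \<mu>\<close> have "AE x in \<mu>. x \<noteq> a"
    using AE_not_in[of "{a}" \<mu>] by auto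
  then have "AE x in \<mu>. indicator (- {a}) x *\<^sub>R u x = u x"
    by eventually_elim simp
  then have "integrable \<mu> u"
    using assms(4,8) integrable_cong_AE_imp[of \<mu> "\<lambda>x. indicator (- {a}) x *\<^sub>R u x" u]
    by (auto simp: set_integrable_def)
  then have \<mu>: "sigma_finite_measure \<mu>"
    using assms(6) by (rule sigma_finite_measureI_pos_integrable)
  have "hardy_inequality \<mu> a q u v (hardy_constant \<mu> a q u v) f" if "f \<in> borel_measurable \<mu>" for f
    using hardy_inequality_hardy_constant[OF assms(1,3,4,5,7) \<mu> that]
      polar_emeasure_sphere[OF \<mu> assms(1,2)] by blast
  moreover have "hardy_constant \<mu> a q u v \<le> C"
    if "\<forall>f\<in>borel_measurable \<mu>. hardy_inequality \<mu> a q u v C f" for C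
    using hardy_constant_le[OF assms(1,3,4,5,7) \<mu> assms(8)] that by blast
  \<comment> \<open>A finite admissible \<open>C\<close> bounds the Hardy constant, and a finite
    Hardy constant is itself admissible.\<close>
  ultimately show ?thesis
    by (meson le_less_trans)
qed

end
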